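(* Let $m\geq0$ and $n\geq1$ be integers and let $c\in\mathcal{C}_{n,m}$. Then for $1\le r\le n+m$, \[ \overline U_{r}(c)=\#\{(i,j):c_{ij}=r\}+\#\{k:\ 1\leq k<r,\ c_{1,n+m-k}=k\}. \] In particular $\overline U_1(c)$ is the number of entries equal to $1$ in $c$, $\overline U_{n+m}(c)$ is the number of saturated parts of $c$, and $\overline U_{n+m-1}(c)=\overline U_{n+m}(c)$.
   Context: $\mathcal{C}_{n,m}$ is the set of plane partitions $c=(c_{ij})_{i,j\geq1}$ (nonnegative integer arrays with finitely many nonzero entries, weakly decreasing along rows and columns) with at most $n$ nonzero columns, nonzero entries strictly decreasing down columns, and each nonzero entry in column $j$ at most $n+m-j$; entries outside the support are $0$. A saturated part is an entry $c_{1j}=n+m-j>0$. $\mathcal{T}_{n,m}$ is the set of arrays $b=(b_{ij})_{1\leq i\leq j\leq n+m-1}$ of integers weakly decreasing along rows and columns with $\max\{n-i,0\}\le b_{ij}\le n$. $\Phi_{n,m}:\mathcal{C}_{n,m}\to\mathcal{T}_{n,m}$ maps $c$ to $b$ with $b_{ij}=n-\#\{l: c_{n+m-j,l}\geq1-i+j\}$. For $b\in\mathcal{T}_{n,m}$, with conventions $b_{i,n+m}=n-i$ and $b_{0,j}=n$, and $1\le r\le n+m$, $U_r(b)=\sum_{s=1}^{n+m-r}(b_{s,s+r-1}-b_{s,s+r})+\sum_{s=n+m-r+1}^{n+m-1}\chi\{b_{s,n+m-1}>n-s\}$ ($\chi\{P\}=1$ if $P$ holds, else $0$). For $c\in\mathcal{C}_{n,m}$,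 $\overline U_r(c)=n+m-1-U_r(\Phi_{n,m}(c))$. *)

theory Defs
  imports Main
begin

text \<open>
  Arrays are indexed from 1, as functions on \<open>nat\<close>; they are normalised to be 0 at indices
  outside their index range, so that each array has exactly one representative.
\<close>

definition plane_partition :: "(nat \<Rightarrow> nat \<Rightarrow> nat) \<Rightarrow> bool" where
  "plane_partition c \<longleftrightarrow>
     (\<forall>i j. i = 0 \<or> j = 0 \<longrightarrow> c i j = 0) \<and>
     finite {(i, j). 1 \<le> i \<and> 1 \<le> j \<and> c i j \<noteq> 0} \<and>
     (\<forall>i\<ge>1. \<forall>j\<ge>1. c i (j + 1) \<le> c i j) \<and>
     (\<forall>i\<ge>1. \<forall>j\<ge>1. c (i + 1) j \<le> c i j)"

text \<open>
  The bound \<open>c i j \<le> n + m - j\<close> is written without truncated subtraction.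
\<close>

definition C_set :: "nat \<Rightarrow> nat \<Rightarrow> (nat \<Rightarrow> nat \<Rightarrow> nat) set" where
  "C_set n m = {c. plane_partition c \<and>
     card {j. 1 \<le> j \<and> (\<exists>i\<ge>1. c i j \<noteq> 0)} \<le> n \<and>
     (\<forall>i\<ge>1. \<forall>j\<ge>1. c (i + 1) j \<noteq> 0 \<longrightarrow> c (i + 1) j < c i j) \<and>
     (\<forall>i\<ge>1. \<forall>j\<ge>1. c i j \<noteq> 0 \<longrightarrow> c i j + j \<le> n + m)}"

definition saturated_columns :: "nat \<Rightarrow> nat \<Rightarrow> (nat \<Rightarrow> nat \<Rightarrow> nat) \<Rightarrow> nat set" where
  "saturated_columns n m c = {j. 1 \<le> j \<and> c 1 j = n + m - j \<and> c 1 j > 0}"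

definition triangle :: "nat \<Rightarrow> nat \<Rightarrow> (nat \<times> nat) set" where
  "triangle n m = {(i, j). 1 \<le> i \<and> i \<le> j \<and> j \<le> n + m - 1}"

definition T_set :: "nat \<Rightarrow> nat \<Rightarrow> (nat \<Rightarrow> nat \<Rightarrow> int) set" where
  "T_set n m = {b.
     (\<forall>i j. (i, j) \<notin> triangle n m \<longrightarrow> b i j = 0) \<and>
     (\<forall>i j. (i, j) \<in> triangle n m \<and> (i, j + 1) \<in> triangle n m \<longrightarrow> b i (j + 1) \<le> b i j) \<and>
     (\<forall>i j. (i, j) \<in> triangle n m \<and> (i + 1, j) \<in> triangle n m \<longrightarrow> b (i + 1) j \<le> b i j) \<and>
     (\<forall>i j. (i, j) \<in> triangle n m \<longrightarrow> max (int n - int i) 0 \<le> b i j \<and> b i j \<le> int n)}"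

text \<open>On the triangle, \<open>i \<le> j\<close>, so \<open>j + 1 - i\<close> is not truncated.\<close>

definition Phi :: "nat \<Rightarrow> nat \<Rightarrow> (nat \<Rightarrow> nat \<Rightarrow> nat) \<Rightarrow> nat \<Rightarrow> nat \<Rightarrow> int" where
  "Phi n m c i j =
     (if (i, j) \<in> triangle n m
      then int n - int (card {l. 1 \<le> l \<and> c (n + m - j) l \<ge> j + 1 - i})
      else 0)"

text \<open>
  The boundary conventions \<open>b\<^bsub>0,j\<^esub> = n\<close> and \<open>b\<^bsub>i,n+m\<^esub> = n - i\<close>, which agree at
  \<open>(0, n + m)\<close>. The value \<open>n - i\<close> may be negative.
\<close>

definition extend :: "nat \<Rightarrow> nat \<Rightarrow> (nat \<Rightarrow> nat \<Rightarrow> int) \<Rightarrow> nat \<Rightarrow> nat \<Rightarrow> int" where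
  "extend n m b i j =
     (if i = 0 then int n else if j = n + m then int n - int i else b i j)"

text \<open>Meaningful for \<open>1 \<le> r \<le> n + m\<close> only.\<close>

definition U :: "nat \<Rightarrow> nat \<Rightarrow> nat \<Rightarrow> (nat \<Rightarrow> nat \<Rightarrow> int) \<Rightarrow> int" where
  "U n m r b =
     (\<Sum>s = 1..n + m - r. extend n m b s (s + r - 1) - extend n m b s (s + r)) +
     (\<Sum>s = n + m - r + 1..n + m - 1. of_bool (extend n m b s (n + m - 1) > int n - int s))"

definition U_bar :: "nat \<Rightarrow> nat \<Rightarrow> nat \<Rightarrow> (nat \<Rightarrow> nat \<Rightarrow> nat) \<Rightarrow> int" where
  "U_bar n m r c = int n + int m - 1 - U n m r (Phi n m c)"

lemma C_set_bound:
  assumes c: "c \<in> C_set n m" and l: "1 \<le> l" and nz: "c (Suc k) l \<noteq> 0"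
  shows "c (Suc k) l + l + k \<le> n + m"
  using nz
proof (induction k)
  case 0
  then show ?case using c l by (auto simp: C_set_def)
next
  case (Suc k)
  have "c (Suc k + 1) l < c (Suc k) l"
    using c l Suc.prems by (simp add: C_set_def)
  with Suc.IH show ?case by simp
qed

lemma Phi_in_T_set:
  assumes c: "c \<in> C_set n m"
  shows "Phi n m c \<in> T_set n m"
proof -
  let ?D = "{j. 1 \<le> j \<and> (\<exists>i\<ge>1. c i j \<noteq> 0)}"
  let ?L = "\<lambda>i j. {l. 1 \<le> l \<and> c (n + m - j) l \<ge> j + 1 - i}"
  have "?D = snd ` {(i, j). 1 \<le> i \<and> 1 \<le> j \<and> c i j \<noteq> 0}"
    by force
  moreover have "finite {(i, j). 1 \<le> i \<and> 1 \<le> j \<and> c i j \<noteq> 0}"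
    using c by (simp add: C_set_def plane_partition_def)
  ultimately have finD: "finite ?D" by simp
  have cardD: "card ?D \<le> n" using c by (simp add: C_set_def)
  have strict: "c (i + 1) j < c i j" if "1 \<le> i" "1 \<le> j" "c (i + 1) j \<noteq> 0" for i j
    using c that by (simp add: C_set_def)
  have sub: "?L i j \<subseteq> ?D" if "(i, j) \<in> triangle n m" for i j
  proof
    fix l assume l: "l \<in> ?L i j"
    have "1 \<le> n + m - j" "c (n + m - j) l \<noteq> 0"
      using that l by (auto simp: triangle_def)
    with l show "l \<in> ?D" by blast
  qed
  have fin: "finite (?L i j)" if "(i, j) \<in> triangle n m" for i j
    using sub[OF that] finD by (rule finite_subset)
  have le_n: "card (?L i j) \<le> n" if "(i, j) \<in> triangle n m" for i j
    using card_mono[OF finD sub[OF that]] cardD by linarith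
  have le_i: "card (?L i j) \<le> i" if t: "(i, j) \<in> triangle n m" for i j
  proof -
    have "?L i j \<subseteq> {1..i}"
    proof
      fix l assume l: "l \<in> ?L i j"
      have k: "n + m - j = Suc (n + m - j - 1)" using t by (auto simp: triangle_def)
      have "c (n + m - j) l + l + (n + m - j - 1) \<le> n + m"
        using C_set_bound[OF c, of l "n + m - j - 1"] l t k by (auto simp: triangle_def)
      then show "l \<in> {1..i}" using l t by (auto simp: triangle_def)
    qed
    from card_mono[OF _ this] show ?thesis by simp
  qed
  have row: "card (?L i j) \<le> card (?L i (j + 1))"
    if t: "(i, j) \<in> triangle n m" "(i, j + 1) \<in> triangle n m" for i j
  proof (rule card_mono[OF fin[OF t(2)]], rule subsetI)
    fix l assume l: "l \<in> ?L i j"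
    have k: "n + m - j = (n + m - (j + 1)) + 1" "1 \<le> n + m - (j + 1)"
      using t by (auto simp: triangle_def)
    have "c (n + m - j) l \<noteq> 0" using l t by (auto simp: triangle_def)
    then have "c (n + m - j) l < c (n + m - (j + 1)) l"
      using strict[OF k(2), of l] l unfolding k(1)[symmetric] by simp
    then show "l \<in> ?L i (j + 1)" using l by auto
  qed
  have col: "card (?L i j) \<le> card (?L (i + 1) j)" if t: "(i + 1, j) \<in> triangle n m" for i j
    by (rule card_mono[OF fin[OF t]]) auto
  have Phi: "Phi n m c i j = int n - int (card (?L i j))" if "(i, j) \<in> triangle n m" for i j
    using that by (simp add: Phi_def)
  show ?thesis
    unfolding T_set_def mem_Collect_eq
  proof (intro conjI allI impI; (elim conjE)?)
    fix i j assume "(i, j) \<notin> triangle n m"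
    then show "Phi n m c i j = 0" by (simp add: Phi_def)
  next
    fix i j assume t: "(i, j) \<in> triangle n m" "(i, j + 1) \<in> triangle n m"
    show "Phi n m c i (j + 1) \<le> Phi n m c i j"
      unfolding Phi[OF t(1)] Phi[OF t(2)] using row[OF t] by linarith
  next
    fix i j assume t: "(i, j) \<in> triangle n m" "(i + 1, j) \<in> triangle n m"
    show "Phi n m c (i + 1) j \<le> Phi n m c i j"
      unfolding Phi[OF t(1)] Phi[OF t(2)] using col[OF t(2)] by linarith
  next
    fix i j assume t: "(i, j) \<in> triangle n m"
    show "max (int n - int i) 0 \<le> Phi n m c i j"
      unfolding Phi[OF t] using le_n[OF t] le_i[OF t] by linarith
    show "Phi n m c i j \<le> int n"
      unfolding Phi[OF t] by linarith
  qed
qed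

end

theory Submission
  imports Defs
begin

text \<open>
  Write \<open>N = n + m\<close> and let \<open>A\<^sub>i(v)\<close> be the number of entries \<open>\<ge> v\<close> in row \<open>i\<close> of \<open>c\<close>. The
  first sum of \<open>U\<^sub>r(\<Phi>(c))\<close> runs, with \<open>i = N - r + 1 - s\<close>, over \<open>A\<^bsub>i-1\<^esub>(r+1) - A\<^sub>i(r)\<close>, where the
  term for \<open>i = 1\<close> comes from the boundary column and contributes \<open>N - r - A\<^sub>1(r)\<close>. Shifting the
  index turns this into \<open>N - r\<close> minus the number of entries equal to \<open>r\<close>. In the second sum, with
  \<open>k = N - s\<close>, the condition reads \<open>A\<^sub>1(k) < N - k\<close>; since always \<open>A\<^sub>1(k) \<le> N - k\<close>, it
  fails exactly if the part in column \<open>N - k\<close> of the first row is at least, hence equal to, \<open>k\<close>.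
\<close>

text \<open>This is the \<open>A\<^sub>i(v)\<close> above, with the threshold \<open>v\<close>
  before the row \<open>i\<close>. Row 0 is allowed because the shifted sum refers to it.\<close>

definition row_count :: "(nat \<Rightarrow> nat \<Rightarrow> nat) \<Rightarrow> nat \<Rightarrow> nat \<Rightarrow> nat" where
  "row_count c v i = card {l. 1 \<le> l \<and> v \<le> c i l}"

lemma C_set_support:
  assumes "c \<in> C_set n m" and "c i l \<noteq> 0"
  shows "1 \<le> i" and "1 \<le> l"
proof -
  have "i = 0 \<or> l = 0 \<longrightarrow> c i l = 0"
    using assms(1) by (simp add: C_set_def plane_partition_def)
  then show "1 \<le> i" "1 \<le> l" using assms(2) by (auto simp: Suc_le_eq)
qed

text \<open>Going up column \<open>l\<close> from row \<open>i\<close> gains at least 1 per row, so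
  \<open>c 1 l\<close> is at least \<open>c i l + i - 1\<close>; the column bound on
  \<open>c 1 l\<close> does the rest.\<close>

lemma C_set_entry_bound:
  assumes "c \<in> C_set n m" and "c i l \<noteq> 0"
  shows "c i l + l + i \<le> n + m + 1"
  using C_set_bound[OF assms(1), of l "i - 1"] C_set_support[OF assms] assms(2) by simp

lemma C_set_row_antimono:
  assumes "c \<in> C_set n m" and "1 \<le> i" and "1 \<le> l" and "l \<le> l'"
  shows "c i l' \<le> c i l"
  using \<open>l \<le> l'\<close>
proof (induction l' rule: dec_induct)
  case base
  show ?case by simp
next
  case (step k)
  have "c i (k + 1) \<le> c i k"
    using assms step.hyps by (simp add: C_set_def plane_partition_def)
  with step.IH show ?case by simp
qed

lemma row_set_subset:
  assumes "c \<in> C_set n m" and "1 \<le> v"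
  shows "{l. 1 \<le> l \<and> v \<le> c i l} \<subseteq> {1..n + m + 1 - i - v}"
proof
  fix l assume "l \<in> {l. 1 \<le> l \<and> v \<le> c i l}"
  then have l: "1 \<le> l" "v \<le> c i l" by auto
  then have "c i l + l + i \<le> n + m + 1"
    using C_set_entry_bound[OF assms(1), of i l] assms(2) by simp
  with l show "l \<in> {1..n + m + 1 - i - v}" by simp
qed

lemma row_count_le:
  assumes "c \<in> C_set n m" and "1 \<le> v"
  shows "row_count c v i \<le> n + m + 1 - i - v"
  using card_mono[OF _ row_set_subset[OF assms]] by (simp add: row_count_def)

lemma row_count_row_zero:
  assumes "c \<in> C_set n m" and "1 \<le> v"
  shows "row_count c v 0 = 0"
proof -
  have "c 0 l = 0" for l
    using C_set_support(1)[OF assms(1), of 0 l] by auto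
  then show ?thesis using assms(2) by (simp add: row_count_def)
qed

lemma card_entries_in_row:
  assumes c: "c \<in> C_set n m" and r: "1 \<le> r"
  shows "int (card {l. 1 \<le> l \<and> c i l = r}) = int (row_count c r i) - int (row_count c (r + 1) i)"
proof -
  have fin: "finite {l. 1 \<le> l \<and> v \<le> c i l}" if "1 \<le> v" for v
    using row_set_subset[OF c that] by (rule finite_subset) simp
  have split: "{l. 1 \<le> l \<and> r \<le> c i l} = {l. 1 \<le> l \<and> c i l = r} \<union> {l. 1 \<le> l \<and> r + 1 \<le> c i l}"
    by auto
  have "finite {l. 1 \<le> l \<and> c i l = r}"
    using fin[OF r] by (rule rev_finite_subset) auto
  moreover have "finite {l. 1 \<le> l \<and> r + 1 \<le> c i l}"
    by (rule fin) simp
  ultimately have "row_count c r i = card {l. 1 \<le> l \<and> c i l = r} + row_count c (r + 1) i"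
    unfolding row_count_def split by (rule card_Un_disjoint) auto
  then show ?thesis by simp
qed

lemma card_entries:
  assumes c: "c \<in> C_set n m" and r: "1 \<le> r"
  shows "int (card {(i, j). 1 \<le> i \<and> 1 \<le> j \<and> c i j = r}) =
    (\<Sum>i = 1..n + m - r. int (row_count c r i) - int (row_count c (r + 1) i))"
proof -
  \<comment> \<open>Rows further down have no room for a part \<open>r\<close>, even in column 1, so
    finitely many rows suffice.\<close>
  have bound: "i \<le> n + m - r" if "c i j = r" "1 \<le> j" for i j
    using C_set_entry_bound[OF c, of i j] that r by auto
  have "{(i, j). 1 \<le> i \<and> 1 \<le> j \<and> c i j = r} =
      (SIGMA i:{1..n + m - r}. {l. 1 \<le> l \<and> c i l = r})"
    using bound by auto
  moreover have "finite {l. 1 \<le> l \<and> c i l = r}" for i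
    by (rule finite_subset[OF subset_trans[OF _ row_set_subset[OF c r, of i]]]) auto
  ultimately have "card {(i, j). 1 \<le> i \<and> 1 \<le> j \<and> c i j = r} =
      (\<Sum>i = 1..n + m - r. card {l. 1 \<le> l \<and> c i l = r})"
    by simp
  then show ?thesis
    by (simp only: of_nat_sum card_entries_in_row[OF c r])
qed

text \<open>On the diagonal \<open>j = s + r - 1\<close> the threshold \<open>j + 1 - s\<close> is
  constantly \<open>r\<close> and only the row varies; on \<open>j = s + r\<close> it is
  \<open>r + 1\<close>. Hence a difference of neighbours compares two thresholds in adjacent
  rows.\<close>

lemma extend_Phi:
  assumes "1 \<le> s" and "s \<le> j" and "j < n + m"
  shows "extend n m (Phi n m c) s j = int n - int (row_count c (j + 1 - s) (n + m - j))"
  using assms by (auto simp: extend_def Phi_def triangle_def row_count_def)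

lemma first_sum:
  assumes c: "c \<in> C_set n m" and r: "1 \<le> r"
  defines "b \<equiv> extend n m (Phi n m c)" and "M \<equiv> n + m - r"
  shows "(\<Sum>s = 1..M. b s (s + r - 1) - b s (s + r)) =
    int M - int (card {(i, j). 1 \<le> i \<and> 1 \<le> j \<and> c i j = r})"
proof -
  let ?g = "\<lambda>i. int (row_count c (r + 1) i)"
  \<comment> \<open>These two values are the boundary terms of the later index shift: row 0 is zero,
    and row \<open>M\<close> has no room for an entry \<open>r + 1\<close>.\<close>
  have ends: "?g 0 = 0" "?g M = 0"
    using row_count_row_zero[OF c, of "r + 1"] row_count_le[OF c, of "r + 1" M]
    by (simp_all add: M_def)
  have "(\<Sum>s = 1..M. b s (s + r - 1) - b s (s + r)) =
      (\<Sum>i = 1..M. b (M + 1 - i) (M + 1 - i + r - 1) - b (M + 1 - i) (M + 1 - i + r))"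
    by (subst sum.atLeastAtMost_rev) simp
  also have "\<dots> = (\<Sum>i = 1..M. (if i = 1 then int M else 0) + ?g (i - 1) - int (row_count c r i))"
  proof (rule sum.cong[OF refl])
    fix i assume i: "i \<in> {1..M}"
    then have N: "n + m = M + r" by (auto simp: M_def)
    have "b (M + 1 - i) (M + 1 - i + r - 1) = int n - int (row_count c r i)"
      using i N r unfolding b_def by (subst extend_Phi) auto
    \<comment> \<open>For \<open>i = 1\<close> the second index is \<open>n + m\<close>, where the
      boundary convention gives \<open>n - M\<close>. Otherwise the entry lies in the triangle and
      reads row \<open>i - 1\<close>.\<close>
    moreover have "b (M + 1 - i) (M + 1 - i + r) = int n - (if i = 1 then int M else 0) - ?g (i - 1)"
    proof (cases "i = 1")
      case True
      then show ?thesis using i N ends by (simp add: b_def extend_def)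
    next
      case False
      then show ?thesis
        using i N r unfolding b_def by (subst extend_Phi) (auto simp: Suc_diff_le)
    qed
    ultimately show "b (M + 1 - i) (M + 1 - i + r - 1) - b (M + 1 - i) (M + 1 - i + r) =
        (if i = 1 then int M else 0) + ?g (i - 1) - int (row_count c r i)"
      by simp
  qed
  also have "\<dots> = int M + (\<Sum>i = 1..M. ?g (i - 1)) - (\<Sum>i = 1..M. int (row_count c r i))"
    by (simp add: sum.distrib sum_subtractf)
  also have "(\<Sum>i = 1..M. ?g (i - 1)) = (\<Sum>i = 1..M. ?g i)"
  proof -
    have "(\<Sum>i = 1..M. ?g (i - 1)) = (\<Sum>i<M. ?g i)"
      by (simp add: sum.atLeast1_atMost_eq)
    also have "\<dots> = (\<Sum>i\<le>M. ?g i)"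
      using ends(2) by (simp flip: lessThan_Suc_atMost)
    also have "\<dots> = (\<Sum>i = 1..M. ?g i)"
      using ends(1) by (simp add: atMost_atLeast0 sum.atLeast_Suc_atMost)
    finally show ?thesis .
  qed
  finally show ?thesis
    using card_entries[OF c r] by (simp add: sum_subtractf M_def)
qed

lemma row_count_first_row_less_iff:
  assumes c: "c \<in> C_set n m" and k: "1 \<le> k" "k < n + m"
  shows "row_count c k 1 < n + m - k \<longleftrightarrow> c 1 (n + m - k) \<noteq> k"
proof
  assume lt: "row_count c k 1 < n + m - k"
  show "c 1 (n + m - k) \<noteq> k"
  proof
    assume eq: "c 1 (n + m - k) = k"
    \<comment> \<open>The row decreases weakly, so a part \<open>k\<close> in column
      \<open>n + m - k\<close> forces parts of size at least \<open>k\<close> in all columns to its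
      left.\<close>
    have "{1..n + m - k} \<subseteq> {l. 1 \<le> l \<and> k \<le> c 1 l}"
      using C_set_row_antimono[OF c, of 1 _ "n + m - k"] eq by auto
    moreover have "finite {l. 1 \<le> l \<and> k \<le> c 1 l}"
      using row_set_subset[OF c k(1)] by (rule finite_subset) simp
    ultimately have "card {1..n + m - k} \<le> row_count c k 1"
      unfolding row_count_def by (intro card_mono)
    with lt show False by simp
  qed
next
  assume neq: "c 1 (n + m - k) \<noteq> k"
  \<comment> \<open>The column bound caps this part at exactly \<open>k\<close>, so being different
    means being smaller.\<close>
  have "c 1 (n + m - k) < k"
    using C_set_entry_bound[OF c, of 1 "n + m - k"] neq k
    by (cases "c 1 (n + m - k) = 0") auto
  then have "n + m - k \<notin> {l. 1 \<le> l \<and> k \<le> c 1 l}" by simp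
  with row_set_subset[OF c k(1), of 1] k
  have "{l. 1 \<le> l \<and> k \<le> c 1 l} \<subset> {1..n + m - k}" by auto
  from psubset_card_mono[OF _ this] show "row_count c k 1 < n + m - k"
    by (simp add: row_count_def)
qed

lemma second_sum:
  assumes c: "c \<in> C_set n m" and r: "1 \<le> r" "r \<le> n + m"
  shows "(\<Sum>s = n + m - r + 1..n + m - 1.
      of_bool (extend n m (Phi n m c) s (n + m - 1) > int n - int s)) =
    int r - 1 - int (card {k. 1 \<le> k \<and> k < r \<and> c 1 (n + m - k) = k})"
proof -
  let ?N = "n + m"
  have "(\<Sum>s = ?N - r + 1..?N - 1.
      of_bool (extend n m (Phi n m c) s (?N - 1) > int n - int s)) =
      (\<Sum>k = 1..<r. of_bool (c 1 (?N - k) \<noteq> k) :: int)"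
  proof (rule sum.reindex_bij_witness[of _ "\<lambda>k. ?N - k" "\<lambda>s. ?N - s"])
    fix s assume s: "s \<in> {?N - r + 1..?N - 1}"
    \<comment> \<open>The last column of the triangle reads the first row of \<open>c\<close>, with
      threshold \<open>?N - s\<close>.\<close>
    have "extend n m (Phi n m c) s (?N - 1) = int n - int (row_count c (?N - s) 1)"
      using s r by (subst extend_Phi) auto
    moreover have "row_count c (?N - s) 1 < s \<longleftrightarrow> c 1 (?N - (?N - s)) \<noteq> ?N - s"
      using row_count_first_row_less_iff[OF c, of "?N - s"] s r by auto
    ultimately show "of_bool (c 1 (?N - (?N - s)) \<noteq> ?N - s) =
        (of_bool (extend n m (Phi n m c) s (?N - 1) > int n - int s) :: int)"
      by simp
  qed (use r in auto)
  also have "\<dots> = (\<Sum>k = 1..<r. 1 - of_bool (c 1 (?N - k) = k))"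
    by (rule sum.cong) auto
  also have "\<dots> = int r - 1 - int (card ({1..<r} \<inter> {k. c 1 (?N - k) = k}))"
    using r by (simp add: sum_subtractf)
  also have "{1..<r} \<inter> {k. c 1 (?N - k) = k} = {k. 1 \<le> k \<and> k < r \<and> c 1 (?N - k) = k}"
    by auto
  finally show ?thesis .
qed

text \<open>The main terms \<open>n + m - r\<close> and \<open>r - 1\<close> of the two sums add up
  to the constant \<open>n + m - 1\<close>, so only the two subtracted cardinalities
  survive.\<close>

lemma U_bar_eq:
  assumes "c \<in> C_set n m" and "1 \<le> r" and "r \<le> n + m"
  shows "U_bar n m r c =
    int (card {(i, j). 1 \<le> i \<and> 1 \<le> j \<and> c i j = r}) +
    int (card {k. 1 \<le> k \<and> k < r \<and> c 1 (n + m - k) = k})"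
  unfolding U_bar_def U_def first_sum[OF assms(1,2)] second_sum[OF assms]
  using assms(3) by simp

text \<open>No part reaches \<open>n + m\<close>: even the corner is at most
  \<open>n + m - 1\<close>.\<close>

lemma U_bar_max:
  assumes c: "c \<in> C_set n m" and N: "1 \<le> n + m"
  shows "U_bar n m (n + m) c = int (card {k. 1 \<le> k \<and> k < n + m \<and> c 1 (n + m - k) = k})"
proof -
  have "\<not> (1 \<le> i \<and> 1 \<le> j \<and> c i j = n + m)" for i j
    using C_set_entry_bound[OF c, of i j] N by linarith
  then have "{(i, j). 1 \<le> i \<and> 1 \<le> j \<and> c i j = n + m} = {}" by auto
  then show ?thesis by (simp only: U_bar_eq[OF c N order.refl]) simp
qed

text \<open>The bijection is \<open>k = n + m - j\<close>. Positivity of \<open>c 1 j\<close> gives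
  \<open>j < n + m\<close>, so the subtraction is not truncated.\<close>

lemma card_saturated_columns:
  "card (saturated_columns n m c) = card {k. 1 \<le> k \<and> k < n + m \<and> c 1 (n + m - k) = k}"
  by (rule bij_betw_same_card[of "\<lambda>j. n + m - j"],
      rule bij_betw_byWitness[where f' = "\<lambda>k. n + m - k"])
    (auto simp: saturated_columns_def)

text \<open>A part \<open>n + m - 1\<close> fits only in the corner. Passing to
  \<open>r = n + m\<close> loses it as an entry equal to \<open>r\<close> but gains it as the
  saturated part with \<open>k = n + m - 1\<close>. The bound \<open>2 \<le> n + m\<close> keeps the
  smaller index at least 1.\<close>

lemma U_bar_submax:
  assumes c: "c \<in> C_set n m" and N: "2 \<le> n + m"
  shows "U_bar n m (n + m - 1) c = U_bar n m (n + m) c"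
proof -
  define K where "K r = {k. 1 \<le> k \<and> k < r \<and> c 1 (n + m - k) = k}" for r
  have corner: "i = 1 \<and> j = 1" if "1 \<le> i" "1 \<le> j" "c i j = n + m - 1" for i j
    using C_set_entry_bound[OF c, of i j] that N by auto
  have E: "{(i, j). 1 \<le> i \<and> 1 \<le> j \<and> c i j = n + m - 1} =
      (if c 1 1 = n + m - 1 then {(1, 1)} else {})"
    using corner by auto
  have fin: "finite (K (n + m - 1))" by (simp add: K_def)
  have "k \<in> K (n + m) \<longleftrightarrow> k \<in> K (n + m - 1) \<or> k = n + m - 1 \<and> c 1 1 = n + m - 1" for k
  proof (cases "k = n + m - 1")
    case True
    moreover from this have "n + m - k = 1" using N by simp
    ultimately show ?thesis using N by (auto simp: K_def)
  qed (auto simp: K_def)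
  then have K: "K (n + m) = (if c 1 1 = n + m - 1 then insert (n + m - 1) (K (n + m - 1))
      else K (n + m - 1))"
    by auto
  have notin: "n + m - 1 \<notin> K (n + m - 1)" by (simp add: K_def)
  have "U_bar n m (n + m - 1) c =
      int (card {(i, j). 1 \<le> i \<and> 1 \<le> j \<and> c i j = n + m - 1}) + int (card (K (n + m - 1)))"
    unfolding K_def by (rule U_bar_eq[OF c]) (use N in auto)
  also have "\<dots> = int (card (K (n + m)))"
    unfolding E K using fin notin by simp
  also have "\<dots> = U_bar n m (n + m) c"
    using U_bar_max[OF c] N by (simp add: K_def)
  finally show ?thesis .
qed

theorem theorem4p1:
  fixes n m :: nat and c :: "nat \<Rightarrow> nat \<Rightarrow> nat"
  assumes "n \<ge> 1" and "c \<in> C_set n m"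
  shows "(\<forall>r. 1 \<le> r \<and> r \<le> n + m \<longrightarrow>
            U_bar n m r c =
              int (card {(i, j). 1 \<le> i \<and> 1 \<le> j \<and> c i j = r}) +
              int (card {k. 1 \<le> k \<and> k < r \<and> c 1 (n + m - k) = k}))
       \<and> U_bar n m 1 c = int (card {(i, j). 1 \<le> i \<and> 1 \<le> j \<and> c i j = 1})
       \<and> U_bar n m (n + m) c = int (card (saturated_columns n m c))
       \<and> (n + m \<ge> 2 \<longrightarrow> U_bar n m (n + m - 1) c = U_bar n m (n + m) c)"
proof (intro conjI allI impI)
  fix r assume "1 \<le> r \<and> r \<le> n + m"
  then show "U_bar n m r c =
      int (card {(i, j). 1 \<le> i \<and> 1 \<le> j \<and> c i j = r}) +
      int (card {k. 1 \<le> k \<and> k < r \<and> c 1 (n + m - k) = k})"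
    using U_bar_eq[OF assms(2)] by blast
next
  have "{k. 1 \<le> k \<and> k < 1 \<and> c 1 (n + m - k) = k} = {}" by auto
  then show "U_bar n m 1 c = int (card {(i, j). 1 \<le> i \<and> 1 \<le> j \<and> c i j = 1})"
    using U_bar_eq[OF assms(2), of 1] assms(1) by (simp only:) simp
next
  show "U_bar n m (n + m) c = int (card (saturated_columns n m c))"
    using U_bar_max[OF assms(2)] assms(1) by (simp add: card_saturated_columns)
next
  assume "n + m \<ge> 2"
  then show "U_bar n m (n + m - 1) c = U_bar n m (n + m) c"
    by (rule U_bar_submax[OF assms(2)])
qed

end
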